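(* Let $n\ge 3$, let $Q=A_{n+2}$ be the linear quiver with initial object $0$, and let $W\subseteq\mathrm{Mor}(Q)$. For any $f\in\mathrm{Mor}(Q)$, we have $f\in\overline W$ if and only if for every module $\rho:Q[W^{-1}]\to\mathrm{Ch}_*$, $\rho(f)$ is a quasi-isomorphism.
   Context: The linear quiver $Q=A_{n+2}$ is regarded as the category associated with a totally ordered set of $n+2$ objects with minimum $0$: $\mathrm{Mor}(x,y)$ has exactly one element if $x\le y$ and is empty otherwise. A set of morphisms $W\subseteq\mathrm{Mor}(Q)$ satisfies the *2-out-of-6 property* if it contains all identities and, whenever $a\xrightarrow{f}b\xrightarrow{g}c\xrightarrow{h}d$ are composable morphisms with $gf\in W$ and $hg\in W$, then $f,g,h,hgf\in W$. The *2-out-of-6 closure* $\overline W$ is the smallest set of morphisms containing $W$ that satisfies the 2-out-of-6 property. $R$ is a fixed nonzero coefficient ring and $\mathrm{Ch}_*$ denotes chain complexes of $R$-modules. A module $\rho:Q[W^{-1}]\to\mathrm{Ch}_*$ means a functor $\rho:Q\to\mathrm{Ch}_*$ with $\rho(0)=0$ that sends every morphism in $W$ to a quasi-isomorphism (a derived module over the localized category $Q[W^{-1}]$, preserving the initial object $0$). *)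

theory Defs
  imports "HOL-Algebra.Algebra"
begin

section \<open>Modules over an arbitrary ring\<close>

text \<open>
  The library locale \<^locale>\<open>module\<close> demands a commutative coefficient ring. The axioms
  below are the same ones for a unital ring that need not be commutative.
\<close>

locale left_module = R?: ring R + M?: abelian_group M
  for R :: "('r, 'k) ring_scheme" (structure) and M :: "('r, 'm, 'l) module_scheme" (structure) +
  assumes smult_closed [simp, intro]:
      "\<lbrakk>a \<in> carrier R; x \<in> carrier M\<rbrakk> \<Longrightarrow> a \<odot>\<^bsub>M\<^esub> x \<in> carrier M"
    and smult_l_distr:
      "\<lbrakk>a \<in> carrier R; b \<in> carrier R; x \<in> carrier M\<rbrakk> \<Longrightarrow>
       (a \<oplus> b) \<odot>\<^bsub>M\<^esub> x = a \<odot>\<^bsub>M\<^esub> x \<oplus>\<^bsub>M\<^esub> b \<odot>\<^bsub>M\<^esub> x"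
    and smult_r_distr:
      "\<lbrakk>a \<in> carrier R; x \<in> carrier M; y \<in> carrier M\<rbrakk> \<Longrightarrow>
       a \<odot>\<^bsub>M\<^esub> (x \<oplus>\<^bsub>M\<^esub> y) = a \<odot>\<^bsub>M\<^esub> x \<oplus>\<^bsub>M\<^esub> a \<odot>\<^bsub>M\<^esub> y"
    and smult_assoc1:
      "\<lbrakk>a \<in> carrier R; b \<in> carrier R; x \<in> carrier M\<rbrakk> \<Longrightarrow>
       (a \<otimes> b) \<odot>\<^bsub>M\<^esub> x = a \<odot>\<^bsub>M\<^esub> (b \<odot>\<^bsub>M\<^esub> x)"
    and smult_one [simp]: "x \<in> carrier M \<Longrightarrow> \<one> \<odot>\<^bsub>M\<^esub> x = x"

lemma module_iff_left_module: "module R M \<longleftrightarrow> cring R \<and> left_module R M"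
  unfolding module_def left_module_def module_axioms_def left_module_axioms_def
  by (auto simp: cring_def)

definition linear_maps ::
  "('r, 'k) ring_scheme \<Rightarrow> ('r, 'a) module \<Rightarrow> ('r, 'b) module \<Rightarrow> ('a \<Rightarrow> 'b) set" where
  "linear_maps R M N =
     {h \<in> carrier M \<rightarrow> carrier N.
        (\<forall>x\<in>carrier M. \<forall>y\<in>carrier M. h (x \<oplus>\<^bsub>M\<^esub> y) = h x \<oplus>\<^bsub>N\<^esub> h y) \<and>
        (\<forall>r\<in>carrier R. \<forall>x\<in>carrier M. h (r \<odot>\<^bsub>M\<^esub> x) = r \<odot>\<^bsub>N\<^esub> h x)}"

definition linear_isos ::
  "('r, 'k) ring_scheme \<Rightarrow> ('r, 'a) module \<Rightarrow> ('r, 'b) module \<Rightarrow> ('a \<Rightarrow> 'b) set" where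
  "linear_isos R M N = {h \<in> linear_maps R M N. bij_betw h (carrier M) (carrier N)}"


section \<open>Chain complexes and quasi-isomorphisms\<close>

text \<open>Complexes are graded by the integers and unbounded; the differential lowers the degree.\<close>

record ('r, 'm) complex_data =
  degree_part :: "int \<Rightarrow> ('r, 'm) module"
  differential :: "int \<Rightarrow> 'm \<Rightarrow> 'm"

definition chain_complex :: "('r, 'k) ring_scheme \<Rightarrow> ('r, 'm) complex_data \<Rightarrow> bool" where
  "chain_complex R C \<longleftrightarrow>
     (\<forall>i. left_module R (degree_part C i)) \<and>
     (\<forall>i. differential C i \<in> linear_maps R (degree_part C i) (degree_part C (i - 1))) \<and>
     (\<forall>i. \<forall>x\<in>carrier (degree_part C i).
        differential C (i - 1) (differential C i x) = \<zero>\<^bsub>degree_part C (i - 2)\<^esub>)"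

definition chain_map ::
  "('r, 'k) ring_scheme \<Rightarrow> ('r, 'a) complex_data \<Rightarrow> ('r, 'b) complex_data \<Rightarrow>
   (int \<Rightarrow> 'a \<Rightarrow> 'b) \<Rightarrow> bool" where
  "chain_map R C D \<phi> \<longleftrightarrow>
     (\<forall>i. \<phi> i \<in> linear_maps R (degree_part C i) (degree_part D i)) \<and>
     (\<forall>i. \<forall>x\<in>carrier (degree_part C i).
        \<phi> (i - 1) (differential C i x) = differential D i (\<phi> i x))"

definition cycles :: "('r, 'm) complex_data \<Rightarrow> int \<Rightarrow> 'm set" where
  "cycles C i = a_kernel (degree_part C i) (degree_part C (i - 1)) (differential C i)"

definition boundaries :: "('r, 'm) complex_data \<Rightarrow> int \<Rightarrow> 'm set" where
  "boundaries C i = differential C (i + 1) ` carrier (degree_part C (i + 1))"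

text \<open>
  The \<open>R\<close>-module of cosets of the boundaries in the cycles. The multiplicative fields that
  the record type inherits from rings play no role for modules. Multiplying a coset by a scalar
  elementwise may give only part of a coset, which is completed by adding the boundaries.
\<close>

definition homology :: "('r, 'm) complex_data \<Rightarrow> int \<Rightarrow> ('r, 'm set) module" where
  "homology C i =
     \<lparr>carrier = (\<lambda>z. boundaries C i +>\<^bsub>degree_part C i\<^esub> z) ` cycles C i,
      monoid.mult = undefined,
      monoid.one = undefined,
      ring.zero = boundaries C i,
      ring.add = (\<lambda>K L. K <+>\<^bsub>degree_part C i\<^esub> L),
      smult = (\<lambda>r K. boundaries C i <+>\<^bsub>degree_part C i\<^esub> (\<lambda>x. r \<odot>\<^bsub>degree_part C i\<^esub> x) ` K)\<rparr>"

text \<open>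
  Likewise, the image of a coset under a chain map may be only part of a coset; see \<open>homology_map_class\<close> for the effect on a homology class.
\<close>

definition homology_map ::
  "('r, 'b) complex_data \<Rightarrow> (int \<Rightarrow> 'a \<Rightarrow> 'b) \<Rightarrow> int \<Rightarrow> 'a set \<Rightarrow> 'b set" where
  "homology_map D \<phi> i K = boundaries D i <+>\<^bsub>degree_part D i\<^esub> \<phi> i ` K"

definition quasi_isomorphism ::
  "('r, 'k) ring_scheme \<Rightarrow> ('r, 'a) complex_data \<Rightarrow> ('r, 'b) complex_data \<Rightarrow>
   (int \<Rightarrow> 'a \<Rightarrow> 'b) \<Rightarrow> bool" where
  "quasi_isomorphism R C D \<phi> \<longleftrightarrow>
     chain_map R C D \<phi> \<and>
     (\<forall>i. homology_map D \<phi> i \<in> linear_isos R (homology C i) (homology D i))"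

lemma homology_carrier:
  "carrier (homology C i) = (\<lambda>z. boundaries C i +>\<^bsub>degree_part C i\<^esub> z) ` cycles C i"
  by (simp add: homology_def)

lemma linear_maps_zero:
  assumes "left_module R M" "left_module R N" "h \<in> linear_maps R M N"
  shows "h \<zero>\<^bsub>M\<^esub> = \<zero>\<^bsub>N\<^esub>"
proof -
  interpret M: left_module R M by fact
  interpret N: left_module R N by fact
  have c: "h \<zero>\<^bsub>M\<^esub> \<in> carrier N" and "h (\<zero>\<^bsub>M\<^esub> \<oplus>\<^bsub>M\<^esub> \<zero>\<^bsub>M\<^esub>) = h \<zero>\<^bsub>M\<^esub> \<oplus>\<^bsub>N\<^esub> h \<zero>\<^bsub>M\<^esub>"
    using assms(3) M.M.zero_closed unfolding linear_maps_def by blast+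
  then show ?thesis
    by (metis M.M.r_zero M.M.zero_closed N.M.add.l_cancel_one')
qed

lemma (in left_module) smult_zero: "a \<in> carrier R \<Longrightarrow> a \<odot>\<^bsub>M\<^esub> \<zero>\<^bsub>M\<^esub> = \<zero>\<^bsub>M\<^esub>"
  by (metis M.add.l_cancel_one' M.r_zero M.zero_closed smult_closed smult_r_distr)

lemma (in left_module) abelian_subgroupI:
  assumes "H \<subseteq> carrier M" "\<zero>\<^bsub>M\<^esub> \<in> H"
    and "\<And>x y. x \<in> H \<Longrightarrow> y \<in> H \<Longrightarrow> x \<oplus>\<^bsub>M\<^esub> y \<in> H"
    and "\<And>r x. r \<in> carrier R \<Longrightarrow> x \<in> H \<Longrightarrow> r \<odot>\<^bsub>M\<^esub> x \<in> H"
  shows "abelian_subgroup H M"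
proof (rule abelian_subgroupI3)
  have neg: "\<ominus>\<^bsub>M\<^esub> x \<in> H" if "x \<in> H" for x
  proof -
    have x: "x \<in> carrier M" using that assms(1) by blast
    have "(\<ominus> \<one>) \<odot>\<^bsub>M\<^esub> x \<oplus>\<^bsub>M\<^esub> x = (\<ominus> \<one> \<oplus> \<one>) \<odot>\<^bsub>M\<^esub> x"
      using x by (simp add: smult_l_distr)
    also have "\<dots> = \<zero>\<^bsub>M\<^esub>"
    proof -
      have "(\<zero> \<oplus> \<zero>) \<odot>\<^bsub>M\<^esub> x = \<zero> \<odot>\<^bsub>M\<^esub> x \<oplus>\<^bsub>M\<^esub> \<zero> \<odot>\<^bsub>M\<^esub> x"
        using x by (intro smult_l_distr) auto
      then have "\<zero> \<odot>\<^bsub>M\<^esub> x = \<zero>\<^bsub>M\<^esub>"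
        using x by (metis M.add.l_cancel_one' R.r_zero R.zero_closed smult_closed)
      then show ?thesis by (simp add: R.l_neg)
    qed
    finally have "\<ominus>\<^bsub>M\<^esub> x = (\<ominus> \<one>) \<odot>\<^bsub>M\<^esub> x"
      using x M.minus_equality by auto
    then show ?thesis using assms(4)[OF _ that] by auto
  qed
  show "additive_subgroup H M"
    unfolding additive_subgroup_def
    by (rule M.add.subgroupI) (use assms neg in \<open>auto simp: a_inv_def\<close>)
  show "abelian_group M" by unfold_locales
qed

lemma (in abelian_subgroup) set_add_coset_part:
  assumes "z \<in> carrier G" "S \<subseteq> H +> z" "S \<noteq> {}"
  shows "H <+>\<^bsub>G\<^esub> S = H +> z"
proof -
  have "H +> s = H +> z" if "s \<in> S" for s
    using that assms a_repr_independence' by blast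
  then have "(\<Union>s\<in>S. H +> s) = H +> z"
    using assms(3) by blast
  moreover have "H <+>\<^bsub>G\<^esub> S = (\<Union>s\<in>S. H +> s)"
    by (auto simp: set_add_def' a_r_coset_def')
  ultimately show ?thesis by simp
qed

context
  fixes R :: "('r, 'k) ring_scheme" and C :: "('r, 'm) complex_data"
  assumes C: "chain_complex R C"
begin

lemma degree_part_left_module: "left_module R (degree_part C i)"
  using C by (simp add: chain_complex_def)

lemma differential_linear:
  "differential C i \<in> linear_maps R (degree_part C i) (degree_part C (i - 1))"
  using C by (simp add: chain_complex_def)

lemma cycles_submodule:
  shows "cycles C i \<subseteq> carrier (degree_part C i)"
    and "\<zero>\<^bsub>degree_part C i\<^esub> \<in> cycles C i"
    and "x \<in> cycles C i \<Longrightarrow> y \<in> cycles C i \<Longrightarrow> x \<oplus>\<^bsub>degree_part C i\<^esub> y \<in> cycles C i"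
    and "r \<in> carrier R \<Longrightarrow> x \<in> cycles C i \<Longrightarrow> r \<odot>\<^bsub>degree_part C i\<^esub> x \<in> cycles C i"
proof -
  interpret M: left_module R "degree_part C i" by (rule degree_part_left_module)
  interpret N: left_module R "degree_part C (i - 1)" by (rule degree_part_left_module)
  note d = differential_linear[of i]
  show "cycles C i \<subseteq> carrier (degree_part C i)"
    by (auto simp: cycles_def a_kernel_def')
  show "\<zero>\<^bsub>degree_part C i\<^esub> \<in> cycles C i"
    using linear_maps_zero[OF M.left_module_axioms N.left_module_axioms d]
    by (auto simp: cycles_def a_kernel_def')
  show "x \<in> cycles C i \<Longrightarrow> y \<in> cycles C i \<Longrightarrow> x \<oplus>\<^bsub>degree_part C i\<^esub> y \<in> cycles C i"
    using d by (auto simp: cycles_def a_kernel_def' linear_maps_def)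
  show "r \<in> carrier R \<Longrightarrow> x \<in> cycles C i \<Longrightarrow> r \<odot>\<^bsub>degree_part C i\<^esub> x \<in> cycles C i"
    using d by (auto simp: cycles_def a_kernel_def' linear_maps_def N.smult_zero)
qed

lemma boundaries_submodule:
  shows "boundaries C i \<subseteq> cycles C i"
    and "\<zero>\<^bsub>degree_part C i\<^esub> \<in> boundaries C i"
    and "x \<in> boundaries C i \<Longrightarrow> y \<in> boundaries C i \<Longrightarrow> x \<oplus>\<^bsub>degree_part C i\<^esub> y \<in> boundaries C i"
    and "r \<in> carrier R \<Longrightarrow> x \<in> boundaries C i \<Longrightarrow> r \<odot>\<^bsub>degree_part C i\<^esub> x \<in> boundaries C i"
proof -
  interpret M: left_module R "degree_part C i" by (rule degree_part_left_module)
  interpret L: left_module R "degree_part C (i + 1)" by (rule degree_part_left_module)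
  have d: "differential C (i + 1) \<in> linear_maps R (degree_part C (i + 1)) (degree_part C i)"
    using differential_linear[of "i + 1"] by simp
  have sq: "differential C i (differential C (i + 1) x) = \<zero>\<^bsub>degree_part C (i - 1)\<^esub>"
    if "x \<in> carrier (degree_part C (i + 1))" for x
  proof -
    have "\<forall>j. \<forall>x\<in>carrier (degree_part C j).
        differential C (j - 1) (differential C j x) = \<zero>\<^bsub>degree_part C (j - 2)\<^esub>"
      using C by (simp add: chain_complex_def)
    from this[rule_format, of x "i + 1"] that show ?thesis by simp
  qed
  show "boundaries C i \<subseteq> cycles C i"
    using d sq by (auto simp: boundaries_def cycles_def a_kernel_def' linear_maps_def)
  show "\<zero>\<^bsub>degree_part C i\<^esub> \<in> boundaries C i"
    using linear_maps_zero[OF L.left_module_axioms M.left_module_axioms d]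
    by (auto simp: boundaries_def intro!: image_eqI[where x = "\<zero>\<^bsub>degree_part C (i + 1)\<^esub>"])
  show "x \<in> boundaries C i \<Longrightarrow> y \<in> boundaries C i \<Longrightarrow> x \<oplus>\<^bsub>degree_part C i\<^esub> y \<in> boundaries C i"
    using d unfolding boundaries_def linear_maps_def
    by (clarsimp, metis (no_types, lifting) L.M.add.m_closed image_eqI)
  show "r \<in> carrier R \<Longrightarrow> x \<in> boundaries C i \<Longrightarrow> r \<odot>\<^bsub>degree_part C i\<^esub> x \<in> boundaries C i"
    using d unfolding boundaries_def linear_maps_def
    by (clarsimp, metis (no_types, lifting) L.smult_closed image_eqI)
qed

lemma boundaries_abelian_subgroup: "abelian_subgroup (boundaries C i) (degree_part C i)"
  by (rule left_module.abelian_subgroupI[OF degree_part_left_module])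
    (use boundaries_submodule cycles_submodule(1) in blast)+

lemma homology_class_add:
  assumes "x \<in> cycles C i" "y \<in> cycles C i"
  shows "(boundaries C i +>\<^bsub>degree_part C i\<^esub> x) \<oplus>\<^bsub>homology C i\<^esub> (boundaries C i +>\<^bsub>degree_part C i\<^esub> y)
    = boundaries C i +>\<^bsub>degree_part C i\<^esub> (x \<oplus>\<^bsub>degree_part C i\<^esub> y)"
  using assms cycles_submodule(1)[of i]
  by (auto simp: homology_def intro!: abelian_subgroup.a_rcos_sum[OF boundaries_abelian_subgroup])

lemma homology_class_smult:
  assumes r: "r \<in> carrier R" and x: "x \<in> cycles C i"
  shows "r \<odot>\<^bsub>homology C i\<^esub> (boundaries C i +>\<^bsub>degree_part C i\<^esub> x)
    = boundaries C i +>\<^bsub>degree_part C i\<^esub> (r \<odot>\<^bsub>degree_part C i\<^esub> x)"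
proof -
  interpret M: left_module R "degree_part C i" by (rule degree_part_left_module)
  interpret B: abelian_subgroup "boundaries C i" "degree_part C i"
    by (rule boundaries_abelian_subgroup)
  have x': "x \<in> carrier (degree_part C i)" using x cycles_submodule(1) by blast
  have sub: "(\<lambda>v. r \<odot>\<^bsub>degree_part C i\<^esub> v) ` (boundaries C i +>\<^bsub>degree_part C i\<^esub> x)
      \<subseteq> boundaries C i +>\<^bsub>degree_part C i\<^esub> (r \<odot>\<^bsub>degree_part C i\<^esub> x)"
    using r x' boundaries_submodule(4)[OF r]
    by (auto simp: a_r_coset_def' M.smult_r_distr[OF r B.a_Hcarr x'])
  have ne: "boundaries C i +>\<^bsub>degree_part C i\<^esub> x \<noteq> {}"
    using x' B.a_rcos_self by blast
  show ?thesis
    using B.set_add_coset_part[OF M.smult_closed[OF r x'] sub] ne by (simp add: homology_def)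
qed

lemma homology_left_module: "left_module R (homology C i)"
proof -
  interpret M: left_module R "degree_part C i" by (rule degree_part_left_module)
  interpret B: abelian_subgroup "boundaries C i" "degree_part C i"
    by (rule boundaries_abelian_subgroup)
  let ?c = "\<lambda>x. boundaries C i +>\<^bsub>degree_part C i\<^esub> x"
  have Z: "x \<in> carrier (degree_part C i)" if "x \<in> cycles C i" for x
    using that cycles_submodule(1) by blast
  have zero: "\<zero>\<^bsub>homology C i\<^esub> = ?c \<zero>\<^bsub>degree_part C i\<^esub>"
    by (simp add: homology_def B.a_subset)
  have neg: "\<ominus>\<^bsub>degree_part C i\<^esub> x \<in> cycles C i" if "x \<in> cycles C i" for x
  proof -
    have "abelian_subgroup (cycles C i) (degree_part C i)"
      by (rule M.abelian_subgroupI) (use cycles_submodule in blast)+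
    then show ?thesis
      using that by (meson abelian_subgroup_def additive_subgroup.a_inv_closed)
  qed
  have group: "abelian_group (homology C i)"
  proof (rule abelian_groupI; unfold homology_carrier zero ball_simps bex_simps; (elim imageE)?; (simp only:)?)
    fix x y z assume xyz: "x \<in> cycles C i" "y \<in> cycles C i" "z \<in> cycles C i"
    note xyz' = this[THEN Z]
    show "?c x \<oplus>\<^bsub>homology C i\<^esub> ?c y \<in> ?c ` cycles C i"
      using xyz by (simp add: homology_class_add cycles_submodule(3))
    show "?c x \<oplus>\<^bsub>homology C i\<^esub> ?c y \<oplus>\<^bsub>homology C i\<^esub> ?c z =
        ?c x \<oplus>\<^bsub>homology C i\<^esub> (?c y \<oplus>\<^bsub>homology C i\<^esub> ?c z)"
      using xyz xyz' by (simp add: homology_class_add cycles_submodule(3) M.M.a_assoc)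
    show "?c x \<oplus>\<^bsub>homology C i\<^esub> ?c y = ?c y \<oplus>\<^bsub>homology C i\<^esub> ?c x"
      using xyz xyz' by (simp add: homology_class_add M.M.a_comm)
    show "?c \<zero>\<^bsub>degree_part C i\<^esub> \<oplus>\<^bsub>homology C i\<^esub> ?c x = ?c x"
      using xyz xyz' by (simp add: homology_class_add cycles_submodule(2))
    show "\<exists>L\<in>cycles C i. ?c L \<oplus>\<^bsub>homology C i\<^esub> ?c x = ?c \<zero>\<^bsub>degree_part C i\<^esub>"
      using xyz xyz' neg
      by (intro bexI[where x = "\<ominus>\<^bsub>degree_part C i\<^esub> x"]) (simp_all add: homology_class_add M.M.l_neg)
  qed (use cycles_submodule(2) in blast)
  have "left_module_axioms R (homology C i)"
  proof (rule left_module_axioms.intro; unfold homology_carrier; elim imageE; hypsubst)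
    fix a b x y assume ab: "a \<in> carrier R" "b \<in> carrier R"
      and xy: "x \<in> cycles C i" "y \<in> cycles C i"
    note xy' = xy[THEN Z]
    note simps = homology_class_add homology_class_smult cycles_submodule(3,4)
    show "a \<odot>\<^bsub>homology C i\<^esub> ?c x \<in> ?c ` cycles C i"
      using ab xy by (simp add: simps)
    show "(a \<oplus>\<^bsub>R\<^esub> b) \<odot>\<^bsub>homology C i\<^esub> ?c x =
        a \<odot>\<^bsub>homology C i\<^esub> ?c x \<oplus>\<^bsub>homology C i\<^esub> b \<odot>\<^bsub>homology C i\<^esub> ?c x"
      using ab xy xy' by (simp add: simps M.smult_l_distr)
    show "a \<odot>\<^bsub>homology C i\<^esub> (?c x \<oplus>\<^bsub>homology C i\<^esub> ?c y) =
        a \<odot>\<^bsub>homology C i\<^esub> ?c x \<oplus>\<^bsub>homology C i\<^esub> a \<odot>\<^bsub>homology C i\<^esub> ?c y"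
      using ab xy xy' by (simp add: simps M.smult_r_distr)
    show "(a \<otimes>\<^bsub>R\<^esub> b) \<odot>\<^bsub>homology C i\<^esub> ?c x =
        a \<odot>\<^bsub>homology C i\<^esub> (b \<odot>\<^bsub>homology C i\<^esub> ?c x)"
      using ab xy xy' by (simp add: simps M.smult_assoc1)
  next
    fix x assume "x \<in> cycles C i"
    then show "\<one>\<^bsub>R\<^esub> \<odot>\<^bsub>homology C i\<^esub> ?c x = ?c x"
      using Z by (simp add: homology_class_smult)
  qed
  then show ?thesis
    using group M.R.ring_axioms by (simp add: left_module_def)
qed

end

lemma homology_map_class:
  assumes C: "chain_complex R C" and D: "chain_complex R D" and \<phi>: "chain_map R C D \<phi>"
    and x: "x \<in> cycles C i"
  shows "\<phi> i x \<in> cycles D i"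
    and "homology_map D \<phi> i (boundaries C i +>\<^bsub>degree_part C i\<^esub> x)
      = boundaries D i +>\<^bsub>degree_part D i\<^esub> \<phi> i x"
proof -
  interpret C: abelian_subgroup "boundaries C i" "degree_part C i"
    by (rule boundaries_abelian_subgroup[OF C])
  interpret D: abelian_subgroup "boundaries D i" "degree_part D i"
    by (rule boundaries_abelian_subgroup[OF D])
  have lin: "\<phi> j \<in> linear_maps R (degree_part C j) (degree_part D j)" for j
    using \<phi> by (simp add: chain_map_def)
  have comm: "\<phi> (j - 1) (differential C j v) = differential D j (\<phi> j v)"
    if "v \<in> carrier (degree_part C j)" for j v
    using \<phi> that by (simp add: chain_map_def)
  have x': "x \<in> carrier (degree_part C i)" using x cycles_submodule(1)[OF C] by blast
  have \<phi>x: "\<phi> i x \<in> carrier (degree_part D i)" using lin[of i] x' by (auto simp: linear_maps_def)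
  have "differential D i (\<phi> i x) = \<phi> (i - 1) \<zero>\<^bsub>degree_part C (i - 1)\<^esub>"
    using comm[OF x'] x by (simp add: cycles_def a_kernel_def')
  also have "\<dots> = \<zero>\<^bsub>degree_part D (i - 1)\<^esub>"
    by (rule linear_maps_zero[OF degree_part_left_module[OF C] degree_part_left_module[OF D] lin])
  finally show "\<phi> i x \<in> cycles D i"
    using \<phi>x by (simp add: cycles_def a_kernel_def')
  have B: "\<phi> i b \<in> boundaries D i" if "b \<in> boundaries C i" for b
  proof -
    obtain c where c: "c \<in> carrier (degree_part C (i + 1))" "b = differential C (i + 1) c"
      using \<open>b \<in> boundaries C i\<close> by (auto simp: boundaries_def)
    then show ?thesis
      using comm[OF c(1)] lin[of "i + 1"] by (auto simp: boundaries_def linear_maps_def)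
  qed
  have sub: "\<phi> i ` (boundaries C i +>\<^bsub>degree_part C i\<^esub> x) \<subseteq> boundaries D i +>\<^bsub>degree_part D i\<^esub> \<phi> i x"
  proof -
    have "\<phi> i (b \<oplus>\<^bsub>degree_part C i\<^esub> x) = \<phi> i b \<oplus>\<^bsub>degree_part D i\<^esub> \<phi> i x"
      if "b \<in> boundaries C i" for b
      using lin[of i] x' C.a_Hcarr[OF that] by (simp add: linear_maps_def)
    then show ?thesis using B by (auto simp: a_r_coset_def')
  qed
  have ne: "boundaries C i +>\<^bsub>degree_part C i\<^esub> x \<noteq> {}"
    using x' C.a_rcos_self by blast
  show "homology_map D \<phi> i (boundaries C i +>\<^bsub>degree_part C i\<^esub> x)
      = boundaries D i +>\<^bsub>degree_part D i\<^esub> \<phi> i x"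
    using D.set_add_coset_part[OF \<phi>x sub] ne by (simp add: homology_map_def)
qed

lemma homology_map_linear:
  assumes C: "chain_complex R C" and D: "chain_complex R D" and \<phi>: "chain_map R C D \<phi>"
  shows "homology_map D \<phi> i \<in> linear_maps R (homology C i) (homology D i)"
proof -
  have lin: "\<phi> i \<in> linear_maps R (degree_part C i) (degree_part D i)"
    using \<phi> by (simp add: chain_map_def)
  note simps = homology_map_class[OF C D \<phi>] homology_class_add[OF C] homology_class_add[OF D]
    homology_class_smult[OF C] homology_class_smult[OF D] cycles_submodule[OF C]
  have Z: "x \<in> carrier (degree_part C i)" if "x \<in> cycles C i" for x
    using that cycles_submodule(1)[OF C] by blast
  show ?thesis
    unfolding linear_maps_def
  proof (intro CollectI conjI ballI funcsetI; unfold homology_carrier; elim imageE; simp only:)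
    fix x y r assume x: "x \<in> cycles C i" and y: "y \<in> cycles C i"
    let ?c = "\<lambda>z. boundaries C i +>\<^bsub>degree_part C i\<^esub> z"
    let ?d = "\<lambda>z. boundaries D i +>\<^bsub>degree_part D i\<^esub> z"
    show "homology_map D \<phi> i (?c x) \<in> ?d ` cycles D i"
      using x by (simp add: simps)
    show "homology_map D \<phi> i (?c x \<oplus>\<^bsub>homology C i\<^esub> ?c y) =
        homology_map D \<phi> i (?c x) \<oplus>\<^bsub>homology D i\<^esub> homology_map D \<phi> i (?c y)"
      using x y lin Z by (simp add: simps) (simp add: linear_maps_def)
    show "homology_map D \<phi> i (r \<odot>\<^bsub>homology C i\<^esub> ?c x) =
        r \<odot>\<^bsub>homology D i\<^esub> homology_map D \<phi> i (?c x)" if "r \<in> carrier R"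
      using that x lin Z by (simp add: simps) (simp add: linear_maps_def)
  qed
qed

section \<open>The linear quiver and 2-out-of-6 closures\<close>

text \<open>
  The objects of the quiver are \<open>0, \<dots>, n + 1\<close>. The unique morphism from \<open>x\<close> to \<open>y\<close> is
  encoded as the pair \<open>(x, y)\<close>, so that \<^const>\<open>fst\<close> and \<^const>\<open>snd\<close> are domain and codomain.
\<close>

definition Obj :: "nat \<Rightarrow> nat set" where
  "Obj n = {..n + 1}"

definition Mor :: "nat \<Rightarrow> (nat \<times> nat) set" where
  "Mor n = {(x, y). x \<in> Obj n \<and> y \<in> Obj n \<and> x \<le> y}"

definition composable :: "nat \<times> nat \<Rightarrow> nat \<times> nat \<Rightarrow> bool" where
  "composable g f \<longleftrightarrow> snd f = fst g"

definition compose_mor :: "nat \<times> nat \<Rightarrow> nat \<times> nat \<Rightarrow> nat \<times> nat" where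
  "compose_mor g f = (fst f, snd g)"

definition two_out_of_six :: "nat \<Rightarrow> (nat \<times> nat) set \<Rightarrow> bool" where
  "two_out_of_six n S \<longleftrightarrow>
     S \<subseteq> Mor n \<and>
     (\<forall>x\<in>Obj n. (x, x) \<in> S) \<and>
     (\<forall>f\<in>Mor n. \<forall>g\<in>Mor n. \<forall>h\<in>Mor n.
        composable g f \<and> composable h g \<and> compose_mor g f \<in> S \<and> compose_mor h g \<in> S \<longrightarrow>
        f \<in> S \<and> g \<in> S \<and> h \<in> S \<and> compose_mor h (compose_mor g f) \<in> S)"

definition two_out_of_six_closure :: "nat \<Rightarrow> (nat \<times> nat) set \<Rightarrow> (nat \<times> nat) set" where
  "two_out_of_six_closure n W = \<Inter>{S. W \<subseteq> S \<and> two_out_of_six n S}"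

lemma two_out_of_six_closure_least:
  assumes "W \<subseteq> Mor n"
  shows "W \<subseteq> two_out_of_six_closure n W"
    and "two_out_of_six n (two_out_of_six_closure n W)"
    and "\<And>S. W \<subseteq> S \<Longrightarrow> two_out_of_six n S \<Longrightarrow> two_out_of_six_closure n W \<subseteq> S"
proof -
  have total: "two_out_of_six n (Mor n)"
    unfolding two_out_of_six_def composable_def compose_mor_def Mor_def by force
  show "W \<subseteq> two_out_of_six_closure n W"
    unfolding two_out_of_six_closure_def by blast
  show "two_out_of_six_closure n W \<subseteq> S" if "W \<subseteq> S" "two_out_of_six n S" for S
    using that unfolding two_out_of_six_closure_def by blast
  have in_all: "x \<in> two_out_of_six_closure n W \<longleftrightarrow> (\<forall>S. W \<subseteq> S \<and> two_out_of_six n S \<longrightarrow> x \<in> S)" for x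
    by (simp add: two_out_of_six_closure_def)
  show "two_out_of_six n (two_out_of_six_closure n W)"
    unfolding two_out_of_six_def[of n "two_out_of_six_closure n W"]
  proof (intro conjI ballI impI)
    show "two_out_of_six_closure n W \<subseteq> Mor n"
      using assms total in_all by blast
    show "(x, x) \<in> two_out_of_six_closure n W" if "x \<in> Obj n" for x
      using that unfolding in_all two_out_of_six_def by blast
    fix f g h
    assume mor: "f \<in> Mor n" "g \<in> Mor n" "h \<in> Mor n"
      and *: "composable g f \<and> composable h g \<and> compose_mor g f \<in> two_out_of_six_closure n W
        \<and> compose_mor h g \<in> two_out_of_six_closure n W"
    have "f \<in> S \<and> g \<in> S \<and> h \<in> S \<and> compose_mor h (compose_mor g f) \<in> S"
      if S: "W \<subseteq> S" "two_out_of_six n S" for S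
    proof -
      have "compose_mor g f \<in> S" "compose_mor h g \<in> S"
        using * S by (auto simp: in_all)
      then show ?thesis
        using * mor S(2) unfolding two_out_of_six_def by blast
    qed
    then show "f \<in> two_out_of_six_closure n W" "g \<in> two_out_of_six_closure n W"
      "h \<in> two_out_of_six_closure n W"
      "compose_mor h (compose_mor g f) \<in> two_out_of_six_closure n W"
      by (simp_all add: in_all)
  qed
qed


section \<open>Derived modules over the localized quiver\<close>

text \<open>
  An object \<open>x\<close> is sent to \<open>ob_part \<rho> x\<close> and a morphism \<open>f\<close> to \<open>mor_part \<rho> f\<close>. Maps are total
  functions in HOL, so equations between chain maps are required on carriers only.
\<close>

record ('r, 'm) functor_data =
  ob_part :: "nat \<Rightarrow> ('r, 'm) complex_data"
  mor_part :: "nat \<times> nat \<Rightarrow> int \<Rightarrow> 'm \<Rightarrow> 'm"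

definition functor_to_Ch :: "('r, 'k) ring_scheme \<Rightarrow> nat \<Rightarrow> ('r, 'm) functor_data \<Rightarrow> bool" where
  "functor_to_Ch R n \<rho> \<longleftrightarrow>
     (\<forall>x\<in>Obj n. chain_complex R (ob_part \<rho> x)) \<and>
     (\<forall>f\<in>Mor n. chain_map R (ob_part \<rho> (fst f)) (ob_part \<rho> (snd f)) (mor_part \<rho> f)) \<and>
     (\<forall>x\<in>Obj n. \<forall>i. \<forall>v\<in>carrier (degree_part (ob_part \<rho> x) i). mor_part \<rho> (x, x) i v = v) \<and>
     (\<forall>f\<in>Mor n. \<forall>g\<in>Mor n. composable g f \<longrightarrow>
        (\<forall>i. \<forall>v\<in>carrier (degree_part (ob_part \<rho> (fst f)) i).
           mor_part \<rho> (compose_mor g f) i v = mor_part \<rho> g i (mor_part \<rho> f i v)))"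

definition zero_complex :: "('r, 'm) complex_data \<Rightarrow> bool" where
  "zero_complex C \<longleftrightarrow> (\<forall>i. carrier (degree_part C i) = {\<zero>\<^bsub>degree_part C i\<^esub>})"

definition localized_module ::
  "('r, 'k) ring_scheme \<Rightarrow> nat \<Rightarrow> (nat \<times> nat) set \<Rightarrow> ('r, 'm) functor_data \<Rightarrow> bool" where
  "localized_module R n W \<rho> \<longleftrightarrow>
     functor_to_Ch R n \<rho> \<and>
     zero_complex (ob_part \<rho> 0) \<and>
     (\<forall>w\<in>W. quasi_isomorphism R (ob_part \<rho> (fst w)) (ob_part \<rho> (snd w)) (mor_part \<rho> w))"

text \<open>
  HOL cannot quantify over types inside a formula, so ``every module'' has to refer to
  modules whose elements are drawn from a fixed type, which plays the role of a universe.
  That type must be able to hold a copy of \<open>R\<close>: over a one-element type all modules vanish.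
  The type below meets this requirement and, as \<open>'m\<close> is arbitrary, also has room for
  the modules on any other type.
\<close>

type_synonym ('r, 'm) universe = "'r + 'm"

end

theory Submission
  imports Defs
begin

text \<open>
  Isomorphisms have the 2-out-of-6 property and homology is a functor, so the morphisms that a
  module inverts form a 2-out-of-6 set. Conversely, a 2-out-of-6 set of morphisms of a linear
  quiver is the same as a noncrossing partition of the objects. The convex hull of a block is then
  a union of blocks, and so the interval module supported on the hull inverts all of \<open>W\<close>. Given two
  objects in different blocks, the hull of one of the two blocks contains neither \<open>0\<close> nor the other
  object.
\<close>

section \<open>Morphisms inverted by a module\<close>

text \<open>The middle map \<open>g\<close> is injective because \<open>h\<close> after
  \<open>g\<close> is, and surjective because \<open>g\<close> after \<open>f\<close> is. Once
  \<open>g\<close> is known to be bijective, it can be cancelled from either composite.\<close>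

lemma bij_betw_two_out_of_six:
  assumes f: "f \<in> A \<rightarrow> B" and g: "g \<in> B \<rightarrow> C" and h: "h \<in> C \<rightarrow> D"
    and gf: "bij_betw (\<lambda>x. g (f x)) A C" and hg: "bij_betw (\<lambda>x. h (g x)) B D"
  shows "bij_betw f A B" "bij_betw g B C" "bij_betw h C D" "bij_betw (\<lambda>x. h (g (f x))) A D"
proof -
  have "inj_on g B"
    using hg by (auto simp: bij_betw_def inj_on_def)
  moreover have "g ` B = C"
    using f g gf by (force simp: bij_betw_def)
  ultimately show bg: "bij_betw g B C"
    by (simp add: bij_betw_def)
  have "f ` A = B"
  proof (intro equalityI subsetI)
    fix y assume y: "y \<in> B"
    then have "g y \<in> (\<lambda>x. g (f x)) ` A"
      using g gf by (auto simp: bij_betw_def)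
    then obtain x where x: "x \<in> A" "g y = g (f x)"
      by blast
    then have "y = f x"
      using \<open>inj_on g B\<close> f y by (auto dest: inj_onD)
    then show "y \<in> f ` A"
      using x by blast
  qed (use f in auto)
  moreover have "inj_on f A"
    using gf by (auto simp: bij_betw_def inj_on_def)
  ultimately show bf: "bij_betw f A B"
    by (simp add: bij_betw_def)
  show "bij_betw h C D"
    using bg hg bij_betw_comp_iff[OF bg, of h D] by (simp add: comp_def)
  show "bij_betw (\<lambda>x. h (g (f x))) A D"
    using bij_betw_trans[OF bf hg] by (simp add: comp_def)
qed

text \<open>A chain map is automatically linear on homology, so bijectivity is the only condition
  left. This reduces questions about quasi-isomorphisms to functions between sets.\<close>

lemma quasi_isomorphism_iff_bij:
  assumes "chain_complex R C" "chain_complex R D" "chain_map R C D \<phi>"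
  shows "quasi_isomorphism R C D \<phi> \<longleftrightarrow>
    (\<forall>i. bij_betw (homology_map D \<phi> i) (carrier (homology C i)) (carrier (homology D i)))"
  using assms homology_map_linear[OF assms]
  by (simp add: quasi_isomorphism_def linear_isos_def)

section \<open>Functoriality of homology\<close>

lemma homology_map_funcset:
  assumes "chain_complex R C" "chain_complex R D" "chain_map R C D \<phi>"
  shows "homology_map D \<phi> i \<in> carrier (homology C i) \<rightarrow> carrier (homology D i)"
  using homology_map_linear[OF assms] by (simp add: linear_maps_def)

text \<open>Evaluated at a cycle representing \<open>K\<close>, both sides are the class of its
  image. The third map \<open>\<chi>\<close> need only agree with the composite on the carrier,
  which is all that a functor provides.\<close>

lemma homology_map_comp:
  assumes C: "chain_complex R C" and D: "chain_complex R D" and E: "chain_complex R E"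
    and \<phi>: "chain_map R C D \<phi>" and \<psi>: "chain_map R D E \<psi>" and \<chi>: "chain_map R C E \<chi>"
    and comp: "\<And>v. v \<in> carrier (degree_part C i) \<Longrightarrow> \<chi> i v = \<psi> i (\<phi> i v)"
    and K: "K \<in> carrier (homology C i)"
  shows "homology_map E \<chi> i K = homology_map E \<psi> i (homology_map D \<phi> i K)"
proof -
  obtain z where z: "z \<in> cycles C i" "K = boundaries C i +>\<^bsub>degree_part C i\<^esub> z"
    using K by (auto simp: homology_carrier)
  then have "z \<in> carrier (degree_part C i)"
    using cycles_submodule(1)[OF C] by blast
  then show ?thesis
    using z by (simp add: comp homology_map_class[OF C D \<phi>] homology_map_class[OF D E \<psi>]
        homology_map_class[OF C E \<chi>])
qed

lemma homology_map_ident: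
  assumes C: "chain_complex R C" and \<phi>: "chain_map R C C \<phi>"
    and ident: "\<And>v. v \<in> carrier (degree_part C i) \<Longrightarrow> \<phi> i v = v"
    and K: "K \<in> carrier (homology C i)"
  shows "homology_map C \<phi> i K = K"
proof -
  obtain z where z: "z \<in> cycles C i" "K = boundaries C i +>\<^bsub>degree_part C i\<^esub> z"
    using K by (auto simp: homology_carrier)
  then have "\<phi> i z = z"
    using ident cycles_submodule(1)[OF C] by blast
  then show ?thesis
    using homology_map_class(2)[OF C C \<phi>] z by simp
qed

lemma quasi_isomorphism_ident:
  assumes C: "chain_complex R C" and \<phi>: "chain_map R C C \<phi>"
    and ident: "\<And>i v. v \<in> carrier (degree_part C i) \<Longrightarrow> \<phi> i v = v"
  shows "quasi_isomorphism R C C \<phi>"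
  unfolding quasi_isomorphism_iff_bij[OF C C \<phi>]
proof
  fix i
  show "bij_betw (homology_map C \<phi> i) (carrier (homology C i)) (carrier (homology C i))"
    using bij_betw_cong[of "carrier (homology C i)" "homology_map C \<phi> i" id]
      homology_map_ident[OF C \<phi> ident] by (simp del: bij_betw_id_iff)
qed

lemma functor_to_Ch_chain_map:
  assumes "functor_to_Ch R n \<rho>" "f \<in> Mor n"
  shows "chain_map R (ob_part \<rho> (fst f)) (ob_part \<rho> (snd f)) (mor_part \<rho> f)"
  using assms by (simp add: functor_to_Ch_def)

section \<open>The 2-out-of-6 property of the inverted morphisms\<close>

definition inverted_morphisms ::
  "('r, 'k) ring_scheme \<Rightarrow> nat \<Rightarrow> ('r, 'm) functor_data \<Rightarrow> (nat \<times> nat) set" where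
  "inverted_morphisms R n \<rho> =
     {f \<in> Mor n. quasi_isomorphism R (ob_part \<rho> (fst f)) (ob_part \<rho> (snd f)) (mor_part \<rho> f)}"

text \<open>In each degree, homology turns three composable morphisms into three composable
  functions, to which \<open>bij_betw_two_out_of_six\<close> applies.\<close>

lemma two_out_of_six_inverted_morphisms:
  assumes \<rho>: "functor_to_Ch R n \<rho>"
  shows "two_out_of_six n (inverted_morphisms R n \<rho>)"
  unfolding two_out_of_six_def
proof (intro conjI ballI impI)
  have ob: "chain_complex R (ob_part \<rho> x)" if "x \<in> Obj n" for x
    using \<rho> that by (simp add: functor_to_Ch_def)
  have mor: "chain_map R (ob_part \<rho> x) (ob_part \<rho> y) (mor_part \<rho> (x, y))" if "(x, y) \<in> Mor n" for x y
    using functor_to_Ch_chain_map[OF \<rho> that] by simp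
  have objs: "x \<in> Obj n" "y \<in> Obj n" if "(x, y) \<in> Mor n" for x y
    using that by (auto simp: Mor_def)
  have trans: "(x, z) \<in> Mor n" if "(x, y) \<in> Mor n" "(y, z) \<in> Mor n" for x y z
    using that by (auto simp: Mor_def)
  let ?H = "\<lambda>x i. carrier (homology (ob_part \<rho> x) i)"
  let ?h = "\<lambda>x y i. homology_map (ob_part \<rho> y) (mor_part \<rho> (x, y)) i"
  have inv_iff: "(x, y) \<in> inverted_morphisms R n \<rho> \<longleftrightarrow> (\<forall>i. bij_betw (?h x y i) (?H x i) (?H y i))"
    if "(x, y) \<in> Mor n" for x y
    using quasi_isomorphism_iff_bij[OF ob ob mor] objs that
    by (simp add: inverted_morphisms_def)
  have fs: "?h x y i \<in> ?H x i \<rightarrow> ?H y i" if "(x, y) \<in> Mor n" for x y i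
    by (rule homology_map_funcset[OF ob ob mor]) (use objs that in auto)
  have comp: "?h x z i K = ?h y z i (?h x y i K)"
    if xy: "(x, y) \<in> Mor n" and yz: "(y, z) \<in> Mor n" and K: "K \<in> ?H x i" for x y z i K
  proof (rule homology_map_comp[OF _ _ _ mor mor mor _ K])
    fix v assume "v \<in> carrier (degree_part (ob_part \<rho> x) i)"
    then show "mor_part \<rho> (x, z) i v = mor_part \<rho> (y, z) i (mor_part \<rho> (x, y) i v)"
      using \<rho> xy yz unfolding functor_to_Ch_def composable_def compose_mor_def
      by (metis fst_conv snd_conv)
  qed (use ob objs trans xy yz in blast)+
  show "inverted_morphisms R n \<rho> \<subseteq> Mor n"
    by (auto simp: inverted_morphisms_def)
  show "(x, x) \<in> inverted_morphisms R n \<rho>" if "x \<in> Obj n" for x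
  proof -
    have "(x, x) \<in> Mor n"
      using that by (simp add: Mor_def)
    moreover have "mor_part \<rho> (x, x) i v = v"
      if "v \<in> carrier (degree_part (ob_part \<rho> x) i)" for i v
      using \<rho> that \<open>x \<in> Obj n\<close> by (simp add: functor_to_Ch_def)
    ultimately show ?thesis
      using quasi_isomorphism_ident[OF ob mor] that by (simp add: inverted_morphisms_def)
  qed
  fix f g h
  assume fgh: "f \<in> Mor n" "g \<in> Mor n" "h \<in> Mor n"
    and *: "composable g f \<and> composable h g \<and> compose_mor g f \<in> inverted_morphisms R n \<rho> \<and>
      compose_mor h g \<in> inverted_morphisms R n \<rho>"
  obtain a b c d where eqs: "f = (a, b)" "g = (b, c)" "h = (c, d)"
    using * by (metis composable_def prod.collapse)
  have m: "(a, b) \<in> Mor n" "(b, c) \<in> Mor n" "(c, d) \<in> Mor n"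
    using fgh eqs by auto
  note m' = trans[OF m(1,2)] trans[OF m(2,3)] trans[OF trans[OF m(1,2)] m(3)]
  \<comment> \<open>The map induced by the composite morphism equals the composite of the induced
    maps only on the homology carrier, hence the passage through a congruence rule.\<close>
  have ac: "bij_betw (\<lambda>K. ?h b c i (?h a b i K)) (?H a i) (?H c i)" for i
  proof (subst bij_betw_cong[OF comp[OF m(1,2), symmetric]])
    show "bij_betw (?h a c i) (?H a i) (?H c i)"
      using * eqs inv_iff[OF m'(1)] by (simp add: compose_mor_def)
  qed
  have bd: "bij_betw (\<lambda>K. ?h c d i (?h b c i K)) (?H b i) (?H d i)" for i
  proof (subst bij_betw_cong[OF comp[OF m(2,3), symmetric]])
    show "bij_betw (?h b d i) (?H b i) (?H d i)"
      using * eqs inv_iff[OF m'(2)] by (simp add: compose_mor_def)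
  qed
  note bij = bij_betw_two_out_of_six[OF fs[OF m(1)] fs[OF m(2)] fs[OF m(3)] ac bd]
  show "f \<in> inverted_morphisms R n \<rho>" "g \<in> inverted_morphisms R n \<rho>"
    "h \<in> inverted_morphisms R n \<rho>"
    using bij(1,2,3) by (simp_all add: eqs inv_iff m)
  have "?h a d i K = ?h c d i (?h b c i (?h a b i K))" if "K \<in> ?H a i" for i K
    using comp[OF m'(1) m(3) that] comp[OF m(1,2) that] by simp
  then have "bij_betw (?h a d i) (?H a i) (?H d i)" for i
    by (subst bij_betw_cong) (use bij(4)[of i] in auto)
  then show "compose_mor h (compose_mor g f) \<in> inverted_morphisms R n \<rho>"
    by (simp add: eqs compose_mor_def inv_iff m'(3))
qed

section \<open>Interval modules\<close>

text \<open>The left ideal is copied into the universe along \<open>Inl\<close>. Taking the ideal as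
  a parameter lets \<open>R\<close> and the zero module share their zero and operations, so that one
  underlying function can serve as a map between them.\<close>

definition left_ideal_module ::
  "('r, 'k) ring_scheme \<Rightarrow> 'r set \<Rightarrow> ('r, ('r, 'm) universe) module" where
  "left_ideal_module R A =
     \<lparr>carrier = Inl ` A, monoid.mult = undefined, monoid.one = undefined,
      ring.zero = Inl \<zero>\<^bsub>R\<^esub>, ring.add = (\<lambda>x y. Inl (projl x \<oplus>\<^bsub>R\<^esub> projl y)),
      smult = (\<lambda>r x. Inl (r \<otimes>\<^bsub>R\<^esub> projl x))\<rparr>"

lemma left_ideal_module_simps [simp]:
  "carrier (left_ideal_module R A) = Inl ` A"
  "\<zero>\<^bsub>left_ideal_module R A\<^esub> = Inl \<zero>\<^bsub>R\<^esub>"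
  "x \<oplus>\<^bsub>left_ideal_module R A\<^esub> y = Inl (projl x \<oplus>\<^bsub>R\<^esub> projl y)"
  "r \<odot>\<^bsub>left_ideal_module R A\<^esub> x = Inl (r \<otimes>\<^bsub>R\<^esub> projl x)"
  by (simp_all add: left_ideal_module_def)

lemma left_module_left_ideal_module:
  fixes R :: "('r, 'k) ring_scheme"
  assumes R: "ring R" and A: "additive_subgroup A R"
    and mult: "\<And>r x. r \<in> carrier R \<Longrightarrow> x \<in> A \<Longrightarrow> r \<otimes>\<^bsub>R\<^esub> x \<in> A"
  shows "left_module R (left_ideal_module R A :: ('r, ('r, 'm) universe) module)"
proof -
  interpret R: ring R by (fact R)
  interpret A: additive_subgroup A R by (fact A)
  let ?M = "left_ideal_module R A :: ('r, ('r, 'm) universe) module"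
  have "abelian_group ?M"
  proof (rule abelian_groupI)
    fix x assume "x \<in> carrier ?M"
    then obtain a where a: "a \<in> A" "x = Inl a"
      unfolding left_ideal_module_simps by blast
    have "Inl (\<ominus>\<^bsub>R\<^esub> a) \<in> carrier ?M"
      using A.a_inv_closed[OF a(1)] by simp
    moreover have "Inl (\<ominus>\<^bsub>R\<^esub> a) \<oplus>\<^bsub>?M\<^esub> x = \<zero>\<^bsub>?M\<^esub>"
      using a A.a_Hcarr by (simp add: R.l_neg)
    ultimately show "\<exists>y\<in>carrier ?M. y \<oplus>\<^bsub>?M\<^esub> x = \<zero>\<^bsub>?M\<^esub>"
      by (rule bexI[rotated])
  qed (auto simp: A.a_Hcarr R.a_ac)
  moreover have "left_module_axioms R ?M"
    by unfold_locales (auto simp: mult A.a_Hcarr R.l_distr R.r_distr R.m_assoc)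
  ultimately show ?thesis
    using R by (simp add: left_module_def)
qed

text \<open>With \<open>M\<close> in every degree and zero differentials, the homology is a copy of
  \<open>M\<close> in every degree, and no degree needs separate treatment.\<close>

definition constant_complex :: "('r, 'm) module \<Rightarrow> ('r, 'm) complex_data" where
  "constant_complex M = \<lparr>degree_part = (\<lambda>i. M), differential = (\<lambda>i v. \<zero>\<^bsub>M\<^esub>)\<rparr>"

lemma degree_part_constant_complex [simp]: "degree_part (constant_complex M) i = M"
  by (simp add: constant_complex_def)

lemma differential_constant_complex [simp]: "differential (constant_complex M) i v = \<zero>\<^bsub>M\<^esub>"
  by (simp add: constant_complex_def)

lemma zero_linear:
  assumes "left_module R M" "left_module R N"
  shows "(\<lambda>v. \<zero>\<^bsub>N\<^esub>) \<in> linear_maps R M N"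
proof -
  interpret N: left_module R N by fact
  show ?thesis by (simp add: linear_maps_def N.smult_zero)
qed

lemma chain_complex_constant_complex:
  assumes "left_module R M"
  shows "chain_complex R (constant_complex M)"
  using assms zero_linear[OF assms assms] by (simp add: chain_complex_def constant_complex_def)

text \<open>Every element is a cycle and only zero is a boundary, so the homology classes are
  singletons. The cardinality is the invariant that later tells \<open>R\<close> from the zero
  module.\<close>

lemma card_homology_constant_complex:
  assumes M: "left_module R M"
  shows "card (carrier (homology (constant_complex M) i)) = card (carrier M)"
proof -
  interpret M: left_module R M by fact
  have "cycles (constant_complex M) i = carrier M"
    by (auto simp: cycles_def a_kernel_def')
  moreover have "boundaries (constant_complex M) i = {\<zero>\<^bsub>M\<^esub>}"
    using M.M.zero_closed by (auto simp: boundaries_def)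
  ultimately have "carrier (homology (constant_complex M) i) = (\<lambda>z. {z}) ` carrier M"
    by (auto simp: homology_carrier a_r_coset_def')
  then show ?thesis
    by (simp add: card_image)
qed

definition interval_module ::
  "('r, 'k) ring_scheme \<Rightarrow> nat set \<Rightarrow> ('r, ('r, 'm) universe) functor_data" where
  "interval_module R I =
     \<lparr>ob_part = (\<lambda>x. constant_complex
        (left_ideal_module R (if x \<in> I then carrier R else {\<zero>\<^bsub>R\<^esub>}))),
      mor_part = (\<lambda>f i v. if fst f \<in> I \<and> snd f \<in> I then v else Inl \<zero>\<^bsub>R\<^esub>)\<rparr>"

section \<open>Interval modules as localized modules\<close>

context
  fixes R :: "('r, 'k) ring_scheme"
  assumes R: "ring R"
begin

interpretation R: ring R by (fact R)

lemma left_module_summand: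
  "left_module R (left_ideal_module R (if P then carrier R else {\<zero>\<^bsub>R\<^esub>}))"
  by (rule left_module_left_ideal_module[OF R])
    (auto intro!: additive_subgroup.intro R.add.subgroupI)

text \<open>Convexity of the interval is what makes composition work: a composite whose two ends lie
  inside cannot pass through an object outside, where it would become zero.\<close>

lemma functor_interval_module: "functor_to_Ch R n (interval_module R {p..q})"
  unfolding functor_to_Ch_def
proof (intro conjI ballI allI impI)
  show ob: "chain_complex R (ob_part (interval_module R {p..q}) x)" for x
    by (simp add: interval_module_def chain_complex_constant_complex left_module_summand)
  show "chain_map R (ob_part (interval_module R {p..q}) (fst f))
    (ob_part (interval_module R {p..q}) (snd f)) (mor_part (interval_module R {p..q}) f)" for f
    using zero_linear[OF left_module_summand left_module_summand, of "fst f \<in> {p..q}" "snd f \<in> {p..q}"]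
    by (auto simp: chain_map_def interval_module_def linear_maps_def)
  show "mor_part (interval_module R {p..q}) (x, x) i v = v"
    if "v \<in> carrier (degree_part (ob_part (interval_module R {p..q}) x) i)" for x i v
    using that by (auto simp: interval_module_def)
  fix f g i v
  assume *: "f \<in> Mor n" "g \<in> Mor n" "composable g f"
    and v: "v \<in> carrier (degree_part (ob_part (interval_module R {p..q}) (fst f)) i)"
  then have "fst f \<le> snd f" "snd f \<le> snd g" "fst g = snd f"
    by (auto simp: Mor_def composable_def)
  then show "mor_part (interval_module R {p..q}) (compose_mor g f) i v =
      mor_part (interval_module R {p..q}) g i (mor_part (interval_module R {p..q}) f i v)"
    by (auto simp: interval_module_def compose_mor_def)
qed

text \<open>If the two ends lie on the same side, the map is the identity of one complex. Otherwise
  a one-element homology module would be in bijection with a copy of the nonzero ring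
  \<open>R\<close>.\<close>

lemma quasi_isomorphism_interval_module_iff:
  assumes nontrivial: "\<one>\<^bsub>R\<^esub> \<noteq> \<zero>\<^bsub>R\<^esub>" and f: "f \<in> Mor n"
  shows "quasi_isomorphism R (ob_part (interval_module R {p..q}) (fst f))
      (ob_part (interval_module R {p..q}) (snd f)) (mor_part (interval_module R {p..q}) f) \<longleftrightarrow>
    (fst f \<in> {p..q} \<longleftrightarrow> snd f \<in> {p..q})"
    (is "quasi_isomorphism R (?ob (fst f)) _ ?\<phi> \<longleftrightarrow> _")
proof
  have ob: "chain_complex R (?ob x)" for x
    by (simp add: interval_module_def chain_complex_constant_complex left_module_summand)
  have \<phi>: "chain_map R (?ob (fst f)) (?ob (snd f)) ?\<phi>"
    by (rule functor_to_Ch_chain_map[OF functor_interval_module f])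
  show "quasi_isomorphism R (?ob (fst f)) (?ob (snd f)) ?\<phi>"
    if both: "fst f \<in> {p..q} \<longleftrightarrow> snd f \<in> {p..q}"
  proof -
    have eq: "?ob (fst f) = ?ob (snd f)"
      unfolding interval_module_def using both by simp
    \<comment> \<open>If both ends lie outside the interval, the carrier contains only zero, which
      the zero map fixes.\<close>
    have "?\<phi> i v = v" if "v \<in> carrier (degree_part (?ob (snd f)) i)" for i v
      using that both by (auto simp: interval_module_def split: if_splits)
    then show ?thesis
      using quasi_isomorphism_ident[OF ob] \<phi> unfolding eq by blast
  qed
  assume qi: "quasi_isomorphism R (?ob (fst f)) (?ob (snd f)) ?\<phi>"
  \<comment> \<open>For an infinite \<open>R\<close> the value of \<open>card\<close> is 0, which
    also differs from 1, so comparing cardinalities is sound without finiteness.\<close>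
  have "card (carrier R) \<noteq> 1"
    using nontrivial by (metis R.one_closed R.zero_closed card_1_singletonE singletonD)
  moreover have card: "card (carrier (homology (?ob x) 0)) =
      (if x \<in> {p..q} then card (carrier R) else 1)" for x
    by (simp add: interval_module_def card_homology_constant_complex[OF left_module_summand]
        card_image)
  moreover have "card (carrier (homology (?ob (fst f)) 0)) = card (carrier (homology (?ob (snd f)) 0))"
    using qi quasi_isomorphism_iff_bij[OF ob ob \<phi>] bij_betw_same_card by blast
  ultimately show "fst f \<in> {p..q} \<longleftrightarrow> snd f \<in> {p..q}"
    by (metis (full_types))
qed

text \<open>The bound \<open>0 < p\<close> keeps the initial object outside the interval, so it is
  sent to zero.\<close>

lemma localized_interval_module:
  assumes "\<one>\<^bsub>R\<^esub> \<noteq> \<zero>\<^bsub>R\<^esub>" "W \<subseteq> Mor n" "0 < p"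
    and "\<And>x y. (x, y) \<in> W \<Longrightarrow> x \<in> {p..q} \<longleftrightarrow> y \<in> {p..q}"
  shows "localized_module R n W (interval_module R {p..q})"
proof -
  have "zero_complex (ob_part (interval_module R {p..q}) 0)"
    using \<open>0 < p\<close> by (simp add: zero_complex_def interval_module_def)
  then show ?thesis
    unfolding localized_module_def
    using assms functor_interval_module quasi_isomorphism_interval_module_iff
    by (metis prod.collapse subsetD)
qed

end

section \<open>Noncrossing partitions\<close>

context
  fixes n :: nat and S :: "(nat \<times> nat) set"
  assumes S: "two_out_of_six n S"
begin

text \<open>The symmetrization of \<open>S\<close> forgets directions; it turns out to be an
  equivalence relation on the objects, whose classes are the blocks.\<close>

definition linked :: "nat \<Rightarrow> nat \<Rightarrow> bool" where
  "linked x y \<longleftrightarrow> (x, y) \<in> S \<or> (y, x) \<in> S"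

lemma linked_sym: "linked x y \<Longrightarrow> linked y x"
  by (auto simp: linked_def)

lemma linked_Obj: "linked x y \<Longrightarrow> x \<in> Obj n \<and> y \<in> Obj n"
  using S by (auto simp: linked_def two_out_of_six_def Mor_def)

lemma linked_refl: "x \<in> Obj n \<Longrightarrow> linked x x"
  using S by (simp add: linked_def two_out_of_six_def)

text \<open>No morphism goes downwards, so a reversed pair in \<open>S\<close> can only be an
  identity.\<close>

lemma linked_le_iff: "x \<le> y \<Longrightarrow> linked x y \<longleftrightarrow> (x, y) \<in> S"
  using S by (auto simp: linked_def two_out_of_six_def Mor_def)

text \<open>This is the noncrossing condition: two crossing links merge into one block. Equalities
  among the four objects are allowed, and these degenerate chains yield transitivity below.\<close>

lemma two_out_of_six_chain:
  assumes le: "a \<le> b" "b \<le> c" "c \<le> d" and "linked a c" "linked b d"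
  shows "linked a b" "linked b c" "linked c d" "linked a d"
proof -
  have "(a, c) \<in> S" "(b, d) \<in> S"
    using assms linked_le_iff by auto
  moreover have "(a, b) \<in> Mor n" "(b, c) \<in> Mor n" "(c, d) \<in> Mor n"
    using assms linked_Obj by (auto simp: Mor_def)
  ultimately have "(a, b) \<in> S \<and> (b, c) \<in> S \<and> (c, d) \<in> S \<and> (a, d) \<in> S"
    using S unfolding two_out_of_six_def composable_def compose_mor_def
    by (metis fst_conv snd_conv)
  then show "linked a b" "linked b c" "linked c d" "linked a d"
    by (auto simp: linked_def)
qed

lemma linked_trans:
  assumes xy: "linked x y" and yz: "linked y z"
  shows "linked x z"
proof -
  have *: "linked u w" if "u \<le> w" "linked u v" "linked v w" for u v w
  proof -
    \<comment> \<open>Repeating \<open>v\<close> in a chain of four objects, one of whose links is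
      then an identity, turns 2-out-of-6 into 2-out-of-3. The position of \<open>v\<close> decides
      which conclusion is read off.\<close>
    consider "v \<le> u" | "u \<le> v" "v \<le> w" | "w \<le> v"
      by linarith
    then show ?thesis
    proof cases
      case 1
      then show ?thesis
        using two_out_of_six_chain(3)[of v v u w] that linked_sym by simp
    next
      case 2
      then show ?thesis
        using two_out_of_six_chain(4)[of u v v w] that by simp
    next
      case 3
      then show ?thesis
        using two_out_of_six_chain(1)[of u w v v] that linked_sym by simp
    qed
  qed
  show ?thesis
  proof (cases "x \<le> z")
    case True
    then show ?thesis
      using * xy yz by blast
  next
    case False
    then show ?thesis
      using *[of z x y] xy yz linked_sym by simp
  qed
qed

text \<open>A link leaving the hull of a block would cross the link between its least and greatest
  elements. Its outer end would then belong to the block and hence to the hull.\<close>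

lemma block_hull:
  assumes c: "c \<in> Obj n"
  obtains p q where "p \<le> c" "c \<le> q" "linked p c" "linked q c"
    "\<And>x y. linked x y \<Longrightarrow> x \<in> {p..q} \<longleftrightarrow> y \<in> {p..q}"
proof -
  define B where "B = {x. linked x c}"
  have "B \<subseteq> Obj n"
    using linked_Obj by (auto simp: B_def)
  then have fin: "finite B"
    using finite_subset by (auto simp: Obj_def)
  have cB: "c \<in> B"
    using c linked_refl by (simp add: B_def)
  define p where "p = Min B"
  define q where "q = Max B"
  have p: "linked p c" and q: "linked q c"
    using Min_in[OF fin] Max_in[OF fin] cB by (auto simp: B_def p_def q_def)
  have le: "p \<le> x \<and> x \<le> q" if "linked x c" for x
    using fin that by (simp add: B_def p_def q_def)
  have pq: "linked p q"
    using linked_trans[OF p linked_sym[OF q]] .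
  have "y \<in> {p..q}" if xy: "linked x y" and x: "x \<in> {p..q}" for x y
  proof (rule ccontr)
    assume "y \<notin> {p..q}"
    then consider "y < p" | "q < y"
      by fastforce
    \<comment> \<open>The chain is \<open>y, p, x, q\<close> in the first case and
      \<open>p, x, q, y\<close> in the second; in both, the link of \<open>x\<close> and
      \<open>y\<close> crosses that of \<open>p\<close> and \<open>q\<close>.\<close>
    then have "linked p y"
    proof cases
      case 1
      then show ?thesis
        using two_out_of_six_chain(1)[of y p x q] x pq linked_sym xy by auto
    next
      case 2
      then show ?thesis
        using two_out_of_six_chain(4)[of p x q y] x pq xy by auto
    qed
    then show False
      using le[of y] linked_trans[OF linked_sym p] \<open>y \<notin> {p..q}\<close> by auto
  qed
  then have "x \<in> {p..q} \<longleftrightarrow> y \<in> {p..q}" if "linked x y" for x y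
    using that linked_sym by blast
  then show thesis
    using that p q le[of c] c linked_refl by blast
qed

text \<open>The hull of the block of the upper object \<open>b\<close> is used if it starts after
  \<open>a\<close>, which also makes its left end positive. Otherwise the block of \<open>b\<close>
  reaches down to \<open>a\<close> or below, and the noncrossing condition traps the block of
  \<open>a\<close> strictly between \<open>p\<close> and \<open>b\<close>.\<close>

lemma separating_interval:
  assumes ab: "(a, b) \<in> Mor n" "(a, b) \<notin> S"
  obtains p q where "0 < p" "\<And>x y. (x, y) \<in> S \<Longrightarrow> x \<in> {p..q} \<longleftrightarrow> y \<in> {p..q}"
    "\<not> (a \<in> {p..q} \<longleftrightarrow> b \<in> {p..q})"
proof -
  have le: "a \<le> b" and objs: "a \<in> Obj n" "b \<in> Obj n" and not_linked: "\<not> linked a b"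
    using ab linked_le_iff by (auto simp: Mor_def)
  obtain p q where pq: "p \<le> b" "b \<le> q" "linked p b"
    "\<And>x y. linked x y \<Longrightarrow> x \<in> {p..q} \<longleftrightarrow> y \<in> {p..q}"
    using block_hull[OF objs(2)] by metis
  obtain p' q' where pq': "p' \<le> a" "a \<le> q'" "linked p' a" "linked q' a"
    "\<And>x y. linked x y \<Longrightarrow> x \<in> {p'..q'} \<longleftrightarrow> y \<in> {p'..q'}"
    using block_hull[OF objs(1)] by metis
  show thesis
  proof (cases "a < p")
    case True
    then show thesis
      using that[of p q] pq le by (auto simp: linked_def)
  next
    case False
    \<comment> \<open>If the block of \<open>a\<close> reached \<open>b\<close> or beyond, the links
      from \<open>p\<close> to \<open>b\<close> and from \<open>a\<close> to \<open>q'\<close> would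
      cross and join \<open>a\<close> to \<open>b\<close>.\<close>
    have "\<not> b \<le> q'"
      using two_out_of_six_chain(2)[of p a b q'] False le pq(3) pq'(4) linked_sym not_linked by auto
    \<comment> \<open>This gives \<open>0 < p'\<close>. Were \<open>p'\<close> at most
      \<open>p\<close>, the links from \<open>p'\<close> to \<open>a\<close> and from
      \<open>p\<close> to \<open>b\<close> would cross.\<close>
    moreover have "p < p'"
    proof (rule ccontr)
      assume "\<not> p < p'"
      then show False
        using two_out_of_six_chain(3)[of p' p a b] False le pq(3) pq'(3) not_linked by auto
    qed
    ultimately show thesis
      using that[of p' q'] pq' by (auto simp: linked_def)
  qed
qed

end

section \<open>The two directions of the equivalence\<close>

theorem proposition1p4:
  fixes R :: "('r, 'k) ring_scheme"
    and n :: nat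
    and W :: "(nat \<times> nat) set"
    and f :: "nat \<times> nat"
  assumes "ring R"
    and "\<one>\<^bsub>R\<^esub> \<noteq> \<zero>\<^bsub>R\<^esub>"
    and "n \<ge> 3"
    and "W \<subseteq> Mor n"
    and "f \<in> Mor n"
  shows "f \<in> two_out_of_six_closure n W \<longleftrightarrow>
    (\<forall>\<rho> :: ('r, ('r, 'm) universe) functor_data. localized_module R n W \<rho> \<longrightarrow>
       quasi_isomorphism R (ob_part \<rho> (fst f)) (ob_part \<rho> (snd f)) (mor_part \<rho> f))"
proof (intro iffI allI impI)
  fix \<rho> :: "('r, ('r, 'm) universe) functor_data"
  assume f: "f \<in> two_out_of_six_closure n W" and \<rho>: "localized_module R n W \<rho>"
  \<comment> \<open>The inverted morphisms form one of the 2-out-of-6 sets containing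
    \<open>W\<close>, so minimality of the closure places \<open>f\<close> among them.\<close>
  have "W \<subseteq> inverted_morphisms R n \<rho>"
    using \<rho> \<open>W \<subseteq> Mor n\<close> by (auto simp: localized_module_def inverted_morphisms_def)
  moreover have "two_out_of_six n (inverted_morphisms R n \<rho>)"
    using \<rho> two_out_of_six_inverted_morphisms by (auto simp: localized_module_def)
  ultimately have "f \<in> inverted_morphisms R n \<rho>"
    using f two_out_of_six_closure_least(3)[OF \<open>W \<subseteq> Mor n\<close>] by blast
  then show "quasi_isomorphism R (ob_part \<rho> (fst f)) (ob_part \<rho> (snd f)) (mor_part \<rho> f)"
    by (simp add: inverted_morphisms_def)
next
  assume *: "\<forall>\<rho> :: ('r, ('r, 'm) universe) functor_data. localized_module R n W \<rho> \<longrightarrow>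
       quasi_isomorphism R (ob_part \<rho> (fst f)) (ob_part \<rho> (snd f)) (mor_part \<rho> f)"
  note closure = two_out_of_six_closure_least[OF \<open>W \<subseteq> Mor n\<close>]
  show "f \<in> two_out_of_six_closure n W"
  proof (rule ccontr)
    assume "f \<notin> two_out_of_six_closure n W"
    \<comment> \<open>The closure itself plays the part of \<open>S\<close>. The interval is
      compatible with all of its morphisms, in particular with those of \<open>W\<close>.\<close>
    then obtain p q where pq: "0 < p"
      "\<And>x y. (x, y) \<in> two_out_of_six_closure n W \<Longrightarrow> x \<in> {p..q} \<longleftrightarrow> y \<in> {p..q}"
      "\<not> (fst f \<in> {p..q} \<longleftrightarrow> snd f \<in> {p..q})"
      using separating_interval[OF closure(2), of "fst f" "snd f"] \<open>f \<in> Mor n\<close>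
      by (metis prod.collapse)
    let ?\<rho> = "interval_module R {p..q} :: ('r, ('r, 'm) universe) functor_data"
    have "localized_module R n W ?\<rho>"
      using localized_interval_module[OF assms(1,2,4) pq(1)] pq(2) closure(1) by blast
    then show False
      using * pq(3) quasi_isomorphism_interval_module_iff[OF assms(1,2,5)] by blast
  qed
qed

end
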